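(* Let $G$ be a finite group of order $n$. Then $$\operatorname{sdim}(\mathcal{P}_E(G))=n-\max\{|\overline{M}|: M\in\mathcal{M}_G\}=n-\max\{|S|: S\subseteq M \text{ for some } M\in \mathcal{M}_G,\text{ and } \mathcal{M}_x\neq\mathcal{M}_y \text{ for all distinct } x,y\in S\}.$$
   Context: All groups are finite. The enhanced power graph $\mathcal{P}_E(G)$ has vertex set $G$, two distinct vertices $x,y$ being adjacent iff $\langle x,y\rangle$ is cyclic. A maximal cyclic subgroup of $G$ is a cyclic subgroup not properly contained in any cyclic subgroup of $G$; $\mathcal{M}_G$ denotes the set of all maximal cyclic subgroups, and for $g\in G$, $\mathcal{M}_g=\{M\in\mathcal{M}_G: g\in M\}$. For $x,y\in G$ write $x\equiv y$ iff $x$ and $y$ have the same closed neighborhood in $\mathcal{P}_E(G)$ (closed neighborhood $N[x]=\{x\}\cup\{$neighbors of $x\}$); $\overline{x}$ denotes the $\equiv$-class of $x$, and for $M\subseteq G$, $\overline{M}=\{\overline{x}: x\in M\}$ (so $|\overline{M}|$ is the number of $\equiv$-classes meeting $M$). For a graph $\Gamma$ and vertices $x,y,z$, $z$ strongly resolves $x$ and $y$ if there is a shortest path from $z$ to $x$ containing $y$ or a shortest path from $z$ to $y$ containing $x$; a strong resolving set is a vertex set $S$ such that every pair of distinct vertices is strongly resolved by some vertex of $S$; $\operatorname{sdim}(\Gamma)$ is the minimum size of a strong resolving set. *)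

theory Defs
  imports "HOL-Algebra.Elementary_Groups" "Graph_Theory.Arc_Walk"
begin

text \<open>
  Undirected graphs are symmetric digraphs, as in the locale \<open>graph\<close> of Graph Theory: an edge
  is a pair of opposite arcs.
\<close>

definition closed_neighborhood :: "('a, 'b) pre_digraph \<Rightarrow> 'a \<Rightarrow> 'a set" where
  "closed_neighborhood \<Gamma> x = {x} \<union> {y. dominates \<Gamma> x y}"

definition neighborhood_class :: "('a, 'b) pre_digraph \<Rightarrow> 'a \<Rightarrow> 'a set" where
  "neighborhood_class \<Gamma> x =
    {y \<in> verts \<Gamma>. closed_neighborhood \<Gamma> y = closed_neighborhood \<Gamma> x}"

definition neighborhood_classes :: "('a, 'b) pre_digraph \<Rightarrow> 'a set \<Rightarrow> 'a set set" where
  "neighborhood_classes \<Gamma> M = neighborhood_class \<Gamma> ` M"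

definition shortest_path :: "('a, 'b) pre_digraph \<Rightarrow> 'a \<Rightarrow> 'b awalk \<Rightarrow> 'a \<Rightarrow> bool" where
  "shortest_path \<Gamma> u p v \<longleftrightarrow>
    pre_digraph.apath \<Gamma> u p v \<and> (\<forall>q. pre_digraph.apath \<Gamma> u q v \<longrightarrow> length p \<le> length q)"

definition strongly_resolves :: "('a, 'b) pre_digraph \<Rightarrow> 'a \<Rightarrow> 'a \<Rightarrow> 'a \<Rightarrow> bool" where
  "strongly_resolves \<Gamma> z x y \<longleftrightarrow>
    (\<exists>p. shortest_path \<Gamma> z p x \<and> y \<in> set (pre_digraph.awalk_verts \<Gamma> z p)) \<or>
    (\<exists>p. shortest_path \<Gamma> z p y \<and> x \<in> set (pre_digraph.awalk_verts \<Gamma> z p))"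

definition strong_resolving_set :: "('a, 'b) pre_digraph \<Rightarrow> 'a set \<Rightarrow> bool" where
  "strong_resolving_set \<Gamma> S \<longleftrightarrow> S \<subseteq> verts \<Gamma> \<and>
    (\<forall>x \<in> verts \<Gamma>. \<forall>y \<in> verts \<Gamma>. x \<noteq> y \<longrightarrow> (\<exists>z \<in> S. strongly_resolves \<Gamma> z x y))"

text \<open>
  Meaningful for finite connected graphs only: in a disconnected graph no vertex set resolves two
  vertices lying in different components.
\<close>
definition sdim :: "('a, 'b) pre_digraph \<Rightarrow> nat" where
  "sdim \<Gamma> = (LEAST k. \<exists>S. strong_resolving_set \<Gamma> S \<and> finite S \<and> card S = k)"

definition enhanced_power_graph :: "('a, 'c) monoid_scheme \<Rightarrow> ('a, 'a \<times> 'a) pre_digraph" where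
  "enhanced_power_graph G = \<lparr>
     verts = carrier G,
     arcs = {(x, y). x \<in> carrier G \<and> y \<in> carrier G \<and> x \<noteq> y \<and>
                     cyclic_group (subgroup_generated G {x, y})},
     tail = fst, head = snd \<rparr>"

definition cyclic_subgroup :: "'a set \<Rightarrow> ('a, 'c) monoid_scheme \<Rightarrow> bool" where
  "cyclic_subgroup H G \<longleftrightarrow> subgroup H G \<and> cyclic_group (G\<lparr>carrier := H\<rparr>)"

definition maximal_cyclic_subgroups :: "('a, 'c) monoid_scheme \<Rightarrow> 'a set set" where
  "maximal_cyclic_subgroups G =
    {M. cyclic_subgroup M G \<and> \<not> (\<exists>C. cyclic_subgroup C G \<and> M \<subset> C)}"

definition maximal_cyclic_subgroups_at :: "('a, 'c) monoid_scheme \<Rightarrow> 'a \<Rightarrow> 'a set set" where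
  "maximal_cyclic_subgroups_at G g = {M \<in> maximal_cyclic_subgroups G. g \<in> M}"

lemma graph_enhanced_power_graph:
  assumes "finite (carrier G)"
  shows "graph (enhanced_power_graph G)"
proof -
  have fin: "finite {(x, y). x \<in> carrier G \<and> y \<in> carrier G \<and> x \<noteq> y \<and>
      cyclic_group (subgroup_generated G {x, y})}"
    by (rule finite_subset[of _ "carrier G \<times> carrier G"]) (use assms in auto)
  show ?thesis
    by unfold_locales
      (use assms fin in \<open>auto simp: enhanced_power_graph_def arc_to_ends_def symmetric_conv insert_commute\<close>)
qed

lemma (in group) maximal_cyclic_subgroups_ne:
  assumes "finite (carrier G)"
  shows "maximal_cyclic_subgroups G \<noteq> {}"
proof -
  let ?C = "{H. cyclic_subgroup H G}"
  have "?C \<subseteq> Pow (carrier G)"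
    by (auto simp: cyclic_subgroup_def dest: subgroup.subset)
  then have fin: "finite ?C" using assms finite_subset by blast
  have "subgroup {\<one>} G" by (rule triv_subgroup)
  moreover from this have "cyclic_group (G\<lparr>carrier := {\<one>}\<rparr>)"
    by (intro trivial_imp_cyclic_group) (auto simp: trivial_group_def intro: subgroup_imp_group)
  ultimately have "{\<one>} \<in> ?C" by (simp add: cyclic_subgroup_def)
  with fin obtain M where "M \<in> ?C" "\<forall>C \<in> ?C. M \<subseteq> C \<longrightarrow> M = C"
    using finite_has_maximal[of ?C] by blast
  then show ?thesis by (auto simp: maximal_cyclic_subgroups_def)
qed

end

theory Submission
  imports Defs "HOL-Algebra.Multiplicative_Group" "HOL-Number_Theory.Cong"
begin

text \<open>
  The identity is adjacent to all other elements, so \<open>\<P>\<^sub>E(G)\<close> has diameter at most 2, and a vertex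
  \<open>z\<close> different from \<open>x\<close> and \<open>y\<close> strongly resolves them iff \<open>x\<close> and \<open>y\<close> are adjacent and \<open>z\<close> lies
  in exactly one of \<open>N[x]\<close> and \<open>N[y]\<close>. Hence strong resolving sets are the complements of
  cliques whose members have distinct closed neighborhoods. A set of elements that pairwise
  generate cyclic subgroups generates a cyclic subgroup, so every clique lies in a maximal cyclic
  subgroup; in particular \<open>N[x]\<close> is the union of \<open>\<M>\<^sub>x\<close> and determines \<open>\<M>\<^sub>x\<close>.
\<close>

section \<open>Strong resolving sets in graphs with a universal vertex\<close>

lemma neighborhood_class_eq_iff:
  assumes "y \<in> verts \<Gamma>"
  shows "neighborhood_class \<Gamma> y = neighborhood_class \<Gamma> x \<longleftrightarrow>
    closed_neighborhood \<Gamma> y = closed_neighborhood \<Gamma> x"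
proof
  have "y \<in> neighborhood_class \<Gamma> y"
    using assms by (simp add: neighborhood_class_def)
  also assume "neighborhood_class \<Gamma> y = neighborhood_class \<Gamma> x"
  finally show "closed_neighborhood \<Gamma> y = closed_neighborhood \<Gamma> x"
    by (simp add: neighborhood_class_def)
qed (simp add: neighborhood_class_def)

context graph
begin

lemma in_closed_neighborhood_sym:
  "y \<in> closed_neighborhood G x \<longleftrightarrow> x \<in> closed_neighborhood G y"
  using arcs_ends_symmetric[OF sym_arcs] by (auto simp: closed_neighborhood_def)

lemma apath_singleton_iff:
  "apath u [a] v \<longleftrightarrow> a \<in> arcs G \<and> tail G a = u \<and> head G a = v"
  using no_loops by (fastforce simp: apath_simps)

text \<open>\<open>apath\<close> demands distinct vertices. Since there are no loops, the midpoint
  differs from both ends automatically, so \<open>u \<noteq> v\<close> is all that distinctness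
  adds.\<close>

lemma apath_pair_iff:
  "apath u [a, b] v \<longleftrightarrow> u \<noteq> v \<and> a \<in> arcs G \<and> b \<in> arcs G \<and>
    tail G a = u \<and> head G a = tail G b \<and> head G b = v"
  using no_loops by (fastforce simp: apath_simps)

lemma dominates_iff_apath: "u \<rightarrow>\<^bsub>G\<^esub> v \<longleftrightarrow> (\<exists>a. apath u [a] v)"
  by (auto simp: apath_singleton_iff arcs_ends_conv)

lemma ex_shortest_path:
  assumes "apath u p v"
  shows "\<exists>q. shortest_path G u q v"
  using ex_has_least_nat[of "\<lambda>p. apath u p v" p length] assms
  by (auto simp: shortest_path_def)

context
  fixes e
  assumes e: "e \<in> verts G" and universal: "\<And>v. v \<in> verts G \<Longrightarrow> v \<in> closed_neighborhood G e"
begin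

lemma ex_apath_length_le_2:
  assumes "u \<in> verts G" "v \<in> verts G"
  shows "\<exists>p. apath u p v \<and> length p \<le> 2"
proof -
  consider "u = v" | "u \<noteq> v" "u = e \<or> v = e" | "u \<noteq> v" "u \<noteq> e" "v \<noteq> e" by blast
  then show ?thesis
  proof cases
    case 1
    then show ?thesis using assms by (intro exI[of _ "[]"]) (simp add: apath_Nil_iff)
  next
    case 2
    then have "u \<rightarrow>\<^bsub>G\<^esub> v"
      using universal assms in_closed_neighborhood_sym by (fastforce simp: closed_neighborhood_def)
    then obtain a where "apath u [a] v" by (auto simp: dominates_iff_apath)
    then show ?thesis by (intro exI[of _ "[a]"]) simp
  next
    case 3
    then have "u \<rightarrow>\<^bsub>G\<^esub> e" "e \<rightarrow>\<^bsub>G\<^esub> v"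
      using universal assms in_closed_neighborhood_sym by (fastforce simp: closed_neighborhood_def)+
    then obtain a b where "apath u [a] e" "apath e [b] v" by (auto simp: dominates_iff_apath)
    with 3 have "apath u [a, b] v" by (auto simp: apath_singleton_iff apath_pair_iff)
    then show ?thesis by (intro exI[of _ "[a, b]"]) simp
  qed
qed

text \<open>Distances are at most 2 because of the detour through \<open>e\<close>. So a shortest
  path from \<open>z\<close> meeting a third vertex \<open>y\<close> before \<open>x\<close> has
  exactly two arcs and midpoint \<open>y\<close>, and such a path is shortest iff no arc joins
  \<open>z\<close> to \<open>x\<close>.\<close>

lemma on_shortest_path_iff:
  assumes "z \<in> verts G" "x \<in> verts G" "z \<noteq> x" "z \<noteq> y" "x \<noteq> y"
  shows "(\<exists>p. shortest_path G z p x \<and> y \<in> set (awalk_verts z p)) \<longleftrightarrow>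
    z \<rightarrow>\<^bsub>G\<^esub> y \<and> y \<rightarrow>\<^bsub>G\<^esub> x \<and> \<not> z \<rightarrow>\<^bsub>G\<^esub> x"
proof
  assume "\<exists>p. shortest_path G z p x \<and> y \<in> set (awalk_verts z p)"
  then obtain p where p: "apath z p x" "\<And>q. apath z q x \<Longrightarrow> length p \<le> length q"
    and y: "y \<in> set (awalk_verts z p)" by (auto simp: shortest_path_def)
  have "length p \<le> 2" using ex_apath_length_le_2[OF assms(1,2)] p(2) by fastforce
  moreover have "p \<noteq> []" using p(1) assms by (auto simp: apath_Nil_iff)
  moreover have "p \<noteq> [a]" for a using p(1) y assms by (auto simp: apath_singleton_iff)
  ultimately obtain a b where ab: "p = [a, b]"
    by (cases p; cases "tl p"; cases "tl (tl p)") auto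
  then have path: "apath z [a, b] x" using p(1) by simp
  then have "head G a = y" using y ab assms by (auto simp: apath_pair_iff)
  then have "apath z [a] y" "apath y [b] x"
    using path by (auto simp: apath_singleton_iff apath_pair_iff)
  moreover have "\<not> z \<rightarrow>\<^bsub>G\<^esub> x" using p(2) ab by (fastforce simp: dominates_iff_apath)
  ultimately show "z \<rightarrow>\<^bsub>G\<^esub> y \<and> y \<rightarrow>\<^bsub>G\<^esub> x \<and> \<not> z \<rightarrow>\<^bsub>G\<^esub> x"
    by (auto simp: dominates_iff_apath)
next
  assume r: "z \<rightarrow>\<^bsub>G\<^esub> y \<and> y \<rightarrow>\<^bsub>G\<^esub> x \<and> \<not> z \<rightarrow>\<^bsub>G\<^esub> x"
  then obtain a b where ab: "apath z [a] y" "apath y [b] x" by (auto simp: dominates_iff_apath)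
  then have path: "apath z [a, b] x"
    using assms by (auto simp: apath_singleton_iff apath_pair_iff)
  have "length [a, b] \<le> length q" if q: "apath z q x" for q
  proof -
    have "q \<noteq> []" using q assms by (auto simp: apath_Nil_iff)
    moreover have "q \<noteq> [c]" for c using q r by (auto simp: dominates_iff_apath)
    ultimately show ?thesis by (cases q; cases "tl q") auto
  qed
  with path have "shortest_path G z [a, b] x" by (simp add: shortest_path_def)
  moreover have "y \<in> set (awalk_verts z [a, b])"
    using ab by (auto simp: apath_singleton_iff)
  ultimately show "\<exists>p. shortest_path G z p x \<and> y \<in> set (awalk_verts z p)" by blast
qed

text \<open>A path contains its own start, so \<open>z\<close> resolves every pair it belongs to.
  For any other \<open>z\<close>, \<open>on_shortest_path_iff\<close> applies with \<open>x\<close>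
  and \<open>y\<close> in both roles; the two alternatives together say that \<open>z\<close> is
  adjacent to exactly one of them.\<close>

lemma strongly_resolves_iff:
  assumes "z \<in> verts G" "x \<in> verts G" "y \<in> verts G" "x \<noteq> y"
  shows "strongly_resolves G z x y \<longleftrightarrow> z = x \<or> z = y \<or>
    x \<rightarrow>\<^bsub>G\<^esub> y \<and> (z \<in> closed_neighborhood G x \<longleftrightarrow> z \<notin> closed_neighborhood G y)"
proof (cases "z = x \<or> z = y")
  case True
  have "\<exists>p. shortest_path G u p v \<and> u \<in> set (awalk_verts u p)"
    if uv: "u \<in> verts G" "v \<in> verts G" for u v
  proof -
    obtain p where "shortest_path G u p v"
      using ex_apath_length_le_2[OF uv] ex_shortest_path by blast
    moreover from this have "u \<in> set (awalk_verts u p)"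
      using hd_in_awalk_verts(2) by (auto simp: shortest_path_def)
    ultimately show ?thesis by blast
  qed
  then show ?thesis using True assms by (auto simp: strongly_resolves_def)
next
  case False
  have sym: "v \<rightarrow>\<^bsub>G\<^esub> u \<longleftrightarrow> u \<rightarrow>\<^bsub>G\<^esub> v" for u v
    using arcs_ends_symmetric[OF sym_arcs] by blast
  have "strongly_resolves G z x y \<longleftrightarrow>
      (z \<rightarrow>\<^bsub>G\<^esub> y \<and> y \<rightarrow>\<^bsub>G\<^esub> x \<and> \<not> z \<rightarrow>\<^bsub>G\<^esub> x) \<or> (z \<rightarrow>\<^bsub>G\<^esub> x \<and> x \<rightarrow>\<^bsub>G\<^esub> y \<and> \<not> z \<rightarrow>\<^bsub>G\<^esub> y)"
    unfolding strongly_resolves_def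
    using on_shortest_path_iff[of z x y] on_shortest_path_iff[of z y x] assms False by simp
  with False show ?thesis by (auto simp: closed_neighborhood_def sym)
qed

lemma strong_resolving_set_iff:
  "strong_resolving_set G S \<longleftrightarrow> S \<subseteq> verts G \<and>
    (\<forall>x \<in> verts G - S. \<forall>y \<in> verts G - S. x \<noteq> y \<longrightarrow>
      x \<rightarrow>\<^bsub>G\<^esub> y \<and> closed_neighborhood G x \<noteq> closed_neighborhood G y)"
    (is "_ \<longleftrightarrow> _ \<and> ?clique")
proof (intro iffI conjI)
  assume S: "strong_resolving_set G S"
  then show sub: "S \<subseteq> verts G" by (simp add: strong_resolving_set_def)
  show ?clique
  proof (intro ballI impI)
    fix x y assume xy: "x \<in> verts G - S" "y \<in> verts G - S" "x \<noteq> y"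
    then obtain z where "z \<in> S" "strongly_resolves G z x y"
      using S unfolding strong_resolving_set_def by blast
    then show "x \<rightarrow>\<^bsub>G\<^esub> y \<and> closed_neighborhood G x \<noteq> closed_neighborhood G y"
      using strongly_resolves_iff[of z x y] xy sub by auto
  qed
next
  assume R: "S \<subseteq> verts G \<and> ?clique"
  have "\<exists>z \<in> S. strongly_resolves G z x y"
    if xy: "x \<in> verts G" "y \<in> verts G" "x \<noteq> y" for x y
  proof (cases "x \<in> S \<or> y \<in> S")
    case True
    then show ?thesis using strongly_resolves_iff xy R by (metis subsetD)
  next
    case False
    then have adj: "x \<rightarrow>\<^bsub>G\<^esub> y" and ne: "closed_neighborhood G x \<noteq> closed_neighborhood G y"
      using R xy by auto
    obtain z where z: "z \<in> closed_neighborhood G x \<longleftrightarrow> z \<notin> closed_neighborhood G y"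
      using ne by blast
    have zv: "z \<in> verts G"
      using z xy adj_in_verts by (auto simp: closed_neighborhood_def)
    \<comment> \<open>Outside \<open>S\<close>, the vertex \<open>z\<close> would belong to the
      clique \<open>verts G - S\<close> and so lie in both closed neighborhoods, but it was chosen
      to lie in only one.\<close>
    have "z \<in> S"
    proof (rule ccontr)
      assume "z \<notin> S"
      then have "w \<in> closed_neighborhood G z" if "w \<in> verts G - S" for w
      proof -
        have "z = w \<or> z \<rightarrow>\<^bsub>G\<^esub> w" using R that zv \<open>z \<notin> S\<close> by blast
        then show ?thesis by (auto simp: closed_neighborhood_def)
      qed
      then have "x \<in> closed_neighborhood G z" "y \<in> closed_neighborhood G z"
        using False xy by blast+
      then show False using z in_closed_neighborhood_sym by blast
    qed
    then show ?thesis using strongly_resolves_iff[OF zv xy] adj z by blast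
  qed
  then show "strong_resolving_set G S" using R by (auto simp: strong_resolving_set_def)
qed

text \<open>By \<open>strong_resolving_set_iff\<close>, complementation exchanges strong resolving
  sets with cliques of distinct closed neighborhoods, so a least set of the first kind comes from a
  largest one of the second.\<close>

lemma sdim_eq:
  assumes C: "C \<subseteq> verts G"
      "\<And>x y. x \<in> C \<Longrightarrow> y \<in> C \<Longrightarrow> x \<noteq> y \<Longrightarrow>
        x \<rightarrow>\<^bsub>G\<^esub> y \<and> closed_neighborhood G x \<noteq> closed_neighborhood G y"
    and max: "\<And>D. D \<subseteq> verts G \<Longrightarrow>
      (\<And>x y. x \<in> D \<Longrightarrow> y \<in> D \<Longrightarrow> x \<noteq> y \<Longrightarrow>
        x \<rightarrow>\<^bsub>G\<^esub> y \<and> closed_neighborhood G x \<noteq> closed_neighborhood G y) \<Longrightarrow> card D \<le> card C"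
  shows "sdim G = card (verts G) - card C"
  unfolding sdim_def
proof (rule Least_equality)
  have "strong_resolving_set G (verts G - C)"
    using C by (auto simp: strong_resolving_set_iff)
  then show "\<exists>S. strong_resolving_set G S \<and> finite S \<and> card S = card (verts G) - card C"
    using C(1) by (intro exI[of _ "verts G - C"]) (simp add: card_Diff_subset finite_subset)
next
  fix k assume "\<exists>S. strong_resolving_set G S \<and> finite S \<and> card S = k"
  then obtain S where S: "strong_resolving_set G S" "finite S" "card S = k" by blast
  then have "card (verts G - S) \<le> card C"
    by (intro max) (auto simp: strong_resolving_set_iff)
  then show "card (verts G) - card C \<le> k"
    using S by (simp add: card_Diff_subset strong_resolving_set_def)
qed

end

end

section \<open>Elements generating a common cyclic subgroup\<close>

text \<open>While a prime divides both numbers, one factor of it can be cancelled from the number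
  with the smaller multiplicity; the lcm stays the same and the sum drops. Coprime numbers are their
  own factors \<open>a\<close> and \<open>b\<close>.\<close>

lemma lcm_coprime_factors:
  fixes m n :: nat
  assumes "m > 0" "n > 0"
  shows "\<exists>a b. a dvd m \<and> b dvd n \<and> coprime a b \<and> lcm m n = a * b"
  using assms
proof (induction "m + n" arbitrary: m n rule: less_induct)
  case less
  have reduce: "\<exists>m' < m. m' > 0 \<and> m' dvd m \<and> lcm m' n = lcm m n"
    if p: "prime p" "p dvd m" "multiplicity p m \<le> multiplicity p n"
      and mn: "m > 0" "n > 0" for p m n :: nat
  proof (intro exI conjI)
    from p obtain m' where m': "m = p * m'" by auto
    show "m div p < m" "m div p > 0" "m div p dvd m"
      using p mn m' prime_gt_1_nat[of p] by auto
    \<comment> \<open>The full power of \<open>p\<close> in \<open>m\<close> divides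
      \<open>n\<close>, and the \<open>p\<close>-free part \<open>r\<close> survives in
      \<open>m div p\<close>. Being coprime, both together divide the lcm, hence so does
      \<open>m\<close>.\<close>
    obtain r where r: "m = p ^ multiplicity p m * r" "\<not> p dvd r"
      using multiplicity_decompose'[of m p] p mn not_prime_unit by blast
    have k: "multiplicity p m > 0"
      using p mn by (simp add: prime_multiplicity_gt_zero_iff)
    have "p ^ multiplicity p m dvd n"
      using p multiplicity_dvd' by blast
    moreover from k obtain l where l: "multiplicity p m = Suc l"
      by (auto simp: gr0_conv_Suc)
    have "m div p = p ^ l * r"
      using p(1) by (subst r(1)) (simp add: l mult.assoc)
    then have "r dvd m div p" by simp
    ultimately have "p ^ multiplicity p m * r dvd lcm (m div p) n"
      using r(2) p(1) by (intro divides_mult) (auto simp: prime_imp_coprime intro: dvd_trans)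
    with r have "m dvd lcm (m div p) n" by simp
    then show "lcm (m div p) n = lcm m n"
      using \<open>m div p dvd m\<close> by (meson dvd_antisym dvd_lcm2 dvd_lcmI1 lcm_least)
  qed
  show ?case
  proof (cases "coprime m n")
    case True
    then show ?thesis
      by (intro exI[of _ m] exI[of _ n]) (simp add: lcm_coprime)
  next
    case False
    then obtain p where p: "prime p" "p dvd m" "p dvd n"
      by (metis coprime_iff_gcd_eq_1 gcd_greatest_iff prime_factor_nat)
    consider "multiplicity p m \<le> multiplicity p n" | "multiplicity p n \<le> multiplicity p m"
      by linarith
    then show ?thesis
    proof cases
      case 1
      from reduce[OF p(1,2) 1 less.prems] obtain m'
        where m': "m' < m" "m' > 0" "m' dvd m" "lcm m' n = lcm m n" by blast
      with less.hyps[of m' n] less.prems show ?thesis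
        by (metis add_less_cancel_right dvd_trans)
    next
      case 2
      from reduce[OF p(1,3) 2 less.prems(2,1)] obtain n'
        where n': "n' < n" "n' > 0" "n' dvd n" "lcm n' m = lcm n m" by blast
      with less.hyps[of m n'] less.prems show ?thesis
        by (metis add_less_cancel_left dvd_trans lcm.commute)
    qed
  qed
qed

context group
begin

lemma generate_singleton_in_carrier:
  "x \<in> generate G {g} \<Longrightarrow> g \<in> carrier G \<Longrightarrow> x \<in> carrier G"
  using generate_in_carrier[of "{g}" x] by simp

lemma generate_singleton_subset:
  assumes "x \<in> generate G {g}" "g \<in> carrier G"
  shows "generate G {x} \<subseteq> generate G {g}"
  using assms generate_subgroup_incl[of "{x}" "generate G {g}"] generate_is_subgroup[of "{g}"]
  by auto

text \<open>By the Chinese remainder theorem some exponent is 1 modulo \<open>ord u\<close> and 0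
  modulo \<open>ord v\<close>; raising the product to it leaves \<open>u\<close>. The second claim
  follows by exchanging the factors.\<close>

lemma coprime_generate_mult:
  assumes u: "u \<in> carrier G" and v: "v \<in> carrier G" and uv: "u \<otimes> v = v \<otimes> u"
    and cop: "coprime (ord u) (ord v)"
  shows "u \<in> generate G {u \<otimes> v}" "v \<in> generate G {u \<otimes> v}"
proof -
  have *: "x \<in> generate G {x \<otimes> y}"
    if x: "x \<in> carrier G" and y: "y \<in> carrier G" and xy: "x \<otimes> y = y \<otimes> x"
      and xy': "coprime (ord x) (ord y)" for x y
  proof -
    obtain k where k: "[k = 1] (mod ord x)" "[k = 0] (mod ord y)"
      using binary_chinese_remainder_nat[OF xy'] by blast
    have "x [^] k = x [^] (1::nat)"
    proof -
      have "int (ord x) dvd int k - int 1"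
        using k(1) by (simp add: cong_iff_dvd_diff flip: cong_int_iff)
      then have "x [^] int 1 = x [^] int k"
        using x int_pow_eq[of x "int 1" "int k"] by simp
      then show ?thesis unfolding int_pow_int by simp
    qed
    moreover have "y [^] k = \<one>"
      using k(2) y by (simp add: pow_eq_id cong_0_iff)
    ultimately have "(x \<otimes> y) [^] k = x"
      using x y by (simp add: pow_mult_distrib[OF xy])
    then have "x = (x \<otimes> y) [^] int k"
      by (simp add: int_pow_int)
    then show ?thesis
      using x y by (auto simp: generate_pow)
  qed
  show "u \<in> generate G {u \<otimes> v}" using * assms by blast
  show "v \<in> generate G {u \<otimes> v}" using *[OF v u] assms by (simp add: coprime_commute)
qed

text \<open>Reflexive closure of adjacency on the carrier of a finite group. Asking for some cyclic
  subgroup containing both elements, rather than for the subgroup they generate to be cyclic, makes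
  inheritance by powers immediate.\<close>

definition cocyclic :: "'a \<Rightarrow> 'a \<Rightarrow> bool" where
  "cocyclic x y \<longleftrightarrow> (\<exists>g \<in> carrier G. x \<in> generate G {g} \<and> y \<in> generate G {g})"

lemma cocyclic_sym: "cocyclic x y \<Longrightarrow> cocyclic y x"
  by (auto simp: cocyclic_def)

lemma cocyclic_carrier: "cocyclic x y \<Longrightarrow> x \<in> carrier G \<and> y \<in> carrier G"
  by (auto simp: cocyclic_def dest: generate_singleton_in_carrier)

lemma cocyclic_generate_left:
  "cocyclic x z \<Longrightarrow> y \<in> generate G {x} \<Longrightarrow> cocyclic y z"
  unfolding cocyclic_def using generate_singleton_subset by blast

lemma cyclic_subgroup_iff:
  "cyclic_subgroup H G \<longleftrightarrow> (\<exists>g \<in> carrier G. H = generate G {g})"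
proof
  assume H: "cyclic_subgroup H G"
  then have sub: "subgroup H G" and "cyclic_group (G\<lparr>carrier := H\<rparr>)"
    by (auto simp: cyclic_subgroup_def)
  then obtain x where x: "x \<in> H" "H = range (\<lambda>n::int. x [^]\<^bsub>G\<lparr>carrier := H\<rparr>\<^esub> n)"
    using group.cyclic_group[OF subgroup_imp_group[OF sub]] by auto
  have xc: "x \<in> carrier G" by (rule subgroup.mem_carrier[OF sub x(1)])
  have "H = range (\<lambda>n::int. x [^] n)"
    using x(2) by (simp only: int_pow_consistent[OF sub x(1)])
  then have "H = generate G {x}" using generate_pow[OF xc] by auto
  with xc show "\<exists>g \<in> carrier G. H = generate G {g}" by blast
next
  assume "\<exists>g \<in> carrier G. H = generate G {g}"
  then obtain g where g: "g \<in> carrier G" "H = generate G {g}" by blast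
  then show "cyclic_subgroup H G"
    using generate_is_subgroup[of "{g}"] cyclic_group_generated[of g]
    by (simp add: cyclic_subgroup_def subgroup_generated_def)
qed

lemma cocyclic_if_mem_cyclic_subgroup:
  "cyclic_subgroup H G \<Longrightarrow> x \<in> H \<Longrightarrow> y \<in> H \<Longrightarrow> cocyclic x y"
  by (auto simp: cyclic_subgroup_iff cocyclic_def)

lemma maximal_cyclic_subgroup_cyclic:
  "M \<in> maximal_cyclic_subgroups G \<Longrightarrow> cyclic_subgroup M G"
  by (simp add: maximal_cyclic_subgroups_def)

lemma cyclic_subgroup_subset_carrier: "cyclic_subgroup H G \<Longrightarrow> H \<subseteq> carrier G"
  by (auto simp: cyclic_subgroup_def dest: subgroup.subset)

context
  assumes fin: "finite (carrier G)"
begin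

section \<open>Powers and orders in a finite group\<close>

lemma generate_singleton_iff:
  "g \<in> carrier G \<Longrightarrow> x \<in> generate G {g} \<longleftrightarrow> (\<exists>k::nat. x = g [^] k)"
  using generate_pow_on_finite_carrier[OF fin] by auto

lemma generate_commute:
  assumes "x \<in> generate G {a}" "y \<in> generate G {b}"
    and "a \<in> carrier G" "b \<in> carrier G" "a \<otimes> b = b \<otimes> a"
  shows "x \<otimes> y = y \<otimes> x"
proof -
  obtain i j :: nat where ij: "x = a [^] i" "y = b [^] j"
    using assms by (auto simp: generate_singleton_iff)
  have "x \<otimes> b = b \<otimes> x"
    using assms ij group_commutes_pow by auto
  then show ?thesis
    using group_commutes_pow[of b x j] assms ij by auto
qed

lemma ord_dvd_if_generate:
  assumes "x \<in> generate G {g}" "g \<in> carrier G"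
  shows "ord x dvd ord g"
proof -
  obtain k :: nat where k: "x = g [^] k" using assms by (auto simp: generate_singleton_iff)
  then have "x [^] ord g = (g [^] ord g) [^] k"
    using assms by (simp only: nat_pow_pow mult.commute)
  then show ?thesis using assms k by (simp flip: pow_eq_id)
qed

text \<open>A finite cyclic group has one subgroup of each possible order, so the subgroup generated
  by \<open>w\<close> contains every element of the group generated by \<open>g\<close> whose order
  divides \<open>ord w\<close>.\<close>

lemma generate_singleton_if_pow_ord:
  assumes g: "g \<in> carrier G" and h: "h \<in> generate G {g}" and w: "w \<in> generate G {g}"
    and "h [^] ord w = \<one>"
  shows "h \<in> generate G {w}"
proof -
  obtain i j :: nat where i: "h = g [^] i" and j: "w = g [^] j"
    using g h w by (auto simp: generate_singleton_iff)
  have w_mem: "w \<in> carrier G" using g j by simp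
  have N: "ord g > 0" using ord_ge_1[OF fin g] by simp
  \<comment> \<open>Both \<open>w\<close> and \<open>g [^] d\<close> generate the subgroup of order
    \<open>ord g / d\<close>. The hypothesis on \<open>h\<close> forces \<open>d dvd i\<close>, and
    Bezout's identity then turns \<open>g [^] i\<close> into a power of \<open>w\<close>.\<close>
  define d where "d = gcd (ord g) j"
  have d: "ord g = d * ord w" "d > 0"
    using g N by (auto simp: j d_def ord_pow_gen)
  have "g [^] (i * ord w) = \<one>" using assms i by (simp add: nat_pow_pow)
  then have "d * ord w dvd i * ord w" using g d by (simp add: pow_eq_id)
  then have "d dvd i" using d N by simp
  then obtain c where c: "i = d * c" by blast
  obtain a b :: int where ab: "a * int (ord g) + b * int j = int d"
    using bezout_int[of "int (ord g)" "int j"] unfolding d_def by auto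
  have "h = g [^] int i" by (simp add: i int_pow_int)
  also have "int i = int d * int c" by (simp add: c)
  also have "int d * int c = int (ord g) * (a * int c) + int j * (b * int c)"
    by (simp add: algebra_simps flip: ab)
  also have "g [^] (int (ord g) * (a * int c) + int j * (b * int c)) =
      (g [^] int (ord g)) [^] (a * int c) \<otimes> (g [^] int j) [^] (b * int c)"
    using g by (simp add: int_pow_mult int_pow_pow)
  also have "\<dots> = w [^] (b * int c)"
    using w_mem g by (simp add: int_pow_int j)
  finally show ?thesis
    using w_mem by (auto simp: generate_pow)
qed

text \<open>Split the lcm of the two orders into coprime factors \<open>a\<close> and
  \<open>b\<close>, and take powers \<open>u\<close> of \<open>x\<close> and \<open>v\<close> of
  \<open>y\<close> with these orders. Their product generates both \<open>x\<close> and
  \<open>y\<close>, and its two factors can be handled separately.\<close>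

lemma cyclic_coprime_decomposition:
  assumes g: "g \<in> carrier G" and x: "x \<in> generate G {g}" and y: "y \<in> generate G {g}"
  obtains u v where "u \<in> generate G {x}" "v \<in> generate G {y}" "coprime (ord u) (ord v)"
    "u \<otimes> v = v \<otimes> u" "x \<in> generate G {u \<otimes> v}" "y \<in> generate G {u \<otimes> v}"
proof -
  have xc: "x \<in> carrier G" and yc: "y \<in> carrier G"
    using g x y generate_singleton_in_carrier by auto
  have pos: "ord x > 0" "ord y > 0"
    using ord_ge_1[OF fin] xc yc by (auto simp: Suc_le_eq)
  obtain a b where ab: "a dvd ord x" "b dvd ord y" "coprime a b" "lcm (ord x) (ord y) = a * b"
    using lcm_coprime_factors[OF pos] by blast
  have ord_root: "ord (z [^] (ord z div k)) = k" if "z \<in> carrier G" "ord z > 0" "k dvd ord z" for z k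
    using that by (subst ord_pow) (auto elim!: dvdE)
  define u v where "u = x [^] (ord x div a)" and "v = y [^] (ord y div b)"
  have ou: "ord u = a" and ov: "ord v = b"
    unfolding u_def v_def using ord_root xc yc pos ab by auto
  have uc: "u \<in> carrier G" and vc: "v \<in> carrier G" using xc yc by (auto simp: u_def v_def)
  have ux: "u \<in> generate G {x}" and vy: "v \<in> generate G {y}"
    using xc yc by (auto simp: u_def v_def generate_singleton_iff)
  have ug: "u \<in> generate G {g}" and vg: "v \<in> generate G {g}"
    using ux vy x y g generate_singleton_subset by blast+
  have comm: "u \<otimes> v = v \<otimes> u" using generate_commute[OF ug vg g g] by simp
  let ?w = "u \<otimes> v"
  have wc: "?w \<in> carrier G" using uc vc by simp
  have wg: "?w \<in> generate G {g}" using ug vg by (rule generate.eng)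
  \<comment> \<open>Coprimality puts \<open>u\<close> and \<open>v\<close> among the powers of
    \<open>?w\<close>, so both orders divide that of \<open>?w\<close>. Hence \<open>ord x\<close>
    and \<open>ord y\<close> divide it too, and inside the cyclic group of \<open>g\<close> this
    suffices for membership.\<close>
  have "a * b dvd ord ?w"
    using coprime_generate_mult[OF uc vc comm] ou ov ab wc ord_dvd_if_generate
    by (intro divides_mult) auto
  then have "ord x dvd ord ?w" "ord y dvd ord ?w"
    using ab(4) by (metis dvd_lcm1 dvd_lcm2 dvd_trans)+
  then have "x \<in> generate G {?w}" "y \<in> generate G {?w}"
    using generate_singleton_if_pow_ord[OF g _ wg] x y xc yc by (auto simp: pow_eq_id)
  with that ux vy comm ou ov ab show thesis by blast
qed

lemma cocyclic_commute: "cocyclic x y \<Longrightarrow> x \<otimes> y = y \<otimes> x"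
  unfolding cocyclic_def using generate_commute by blast

text \<open>
  Splitting \<open>u, z\<close> and then \<open>v, z\<^sub>1\<close> into parts of coprime orders leaves \<open>u\<^sub>1\<close> of order coprime to that of
  a generator \<open>k\<close> of \<open>\<langle>v, z\<^sub>1\<rangle>\<close>, so that \<open>u\<^sub>1 k\<close> generates \<open>u\<close>, \<open>v\<close> and \<open>z\<close> at once.
\<close>
lemma cocyclic_coprime_mult:
  assumes comm: "u \<otimes> v = v \<otimes> u" and cop: "coprime (ord u) (ord v)"
    and zu: "cocyclic z u" and zv: "cocyclic z v"
  shows "cocyclic z (u \<otimes> v)"
proof -
  have mem: "z \<in> carrier G" "u \<in> carrier G" "v \<in> carrier G"
    using zu zv cocyclic_carrier by auto
  obtain u1 z1 where u1: "u1 \<in> generate G {u}" and z1: "z1 \<in> generate G {z}"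
    and cop1: "coprime (ord u1) (ord z1)"
    and w1: "u \<in> generate G {u1 \<otimes> z1}" "z \<in> generate G {u1 \<otimes> z1}"
    using zu cyclic_coprime_decomposition unfolding cocyclic_def by metis
  obtain v1 z2 where v1: "v1 \<in> generate G {v}" and z2: "z2 \<in> generate G {z1}"
    and comm2: "v1 \<otimes> z2 = z2 \<otimes> v1"
    and w2: "v \<in> generate G {v1 \<otimes> z2}" "z1 \<in> generate G {v1 \<otimes> z2}"
    using cocyclic_generate_left[OF zv z1] cyclic_coprime_decomposition unfolding cocyclic_def
    by metis
  have z2z: "z2 \<in> generate G {z}" using z1 z2 mem generate_singleton_subset by blast
  have mem': "u1 \<in> carrier G" "z1 \<in> carrier G" "v1 \<in> carrier G" "z2 \<in> carrier G"
    using u1 z1 v1 z2z mem generate_singleton_in_carrier by auto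
  define k where "k = v1 \<otimes> z2"
  have kc: "k \<in> carrier G" using mem' by (simp add: k_def)
  have "u1 \<otimes> v1 = v1 \<otimes> u1"
    using generate_commute[OF u1 v1] mem comm by simp
  moreover have "u1 \<otimes> z2 = z2 \<otimes> u1"
    using generate_commute[OF u1 z2z] mem cocyclic_commute[OF zu] by simp
  ultimately have commk: "u1 \<otimes> k = k \<otimes> u1"
    unfolding k_def using mem' by (metis m_assoc)
  \<comment> \<open>Both factors of this bound are coprime to \<open>ord u1\<close>: the first since
    \<open>ord u1\<close> divides \<open>ord u\<close>, the second by the first splitting.\<close>
  have "ord k dvd ord v * ord z1"
    unfolding k_def using ord_mul_divides[OF comm2] mem' ord_dvd_if_generate[OF v1] ord_dvd_if_generate[OF z2] mem
    by (meson dvd_trans mult_dvd_mono)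
  moreover have "coprime (ord u1) (ord v * ord z1)"
    using cop cop1 ord_dvd_if_generate[OF u1] mem coprime_divisors by auto
  ultimately have "coprime (ord u1) (ord k)"
    using coprime_divisors dvd_refl by metis
  note uk = coprime_generate_mult[OF mem'(1) kc commk this]
  define h where "h = u1 \<otimes> k"
  have h: "h \<in> carrier G" using mem' kc by (simp add: h_def)
  have kh: "generate G {k} \<subseteq> generate G {h}"
    using uk(2) h generate_singleton_subset by (simp add: h_def)
  \<comment> \<open>\<open>z1\<close> is a power of \<open>k\<close>, so \<open>h\<close> generates
    both factors; their product in turn generates \<open>u\<close> and \<open>z\<close>.\<close>
  then have "u1 \<otimes> z1 \<in> generate G {h}"
    using uk(1) w2(2) by (intro generate.eng) (auto simp: h_def k_def)
  then have "generate G {u1 \<otimes> z1} \<subseteq> generate G {h}"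
    using h generate_singleton_subset by blast
  then have "u \<otimes> v \<in> generate G {h}" "z \<in> generate G {h}"
    using w1 w2(1) kh by (auto simp: k_def intro: generate.eng)
  then show ?thesis using h by (auto simp: cocyclic_def)
qed

text \<open>Elements are added one at a time: the new element and the old generator are cocyclic,
  and the product from \<open>cyclic_coprime_decomposition\<close> generates both.\<close>

lemma pairwise_cocyclic_imp_cyclic:
  assumes "finite C" "C \<subseteq> carrier G" "\<And>x y. x \<in> C \<Longrightarrow> y \<in> C \<Longrightarrow> cocyclic x y"
  shows "\<exists>h \<in> carrier G. C \<subseteq> generate G {h}"
proof -
  \<comment> \<open>The second conjunct makes the generator of the old set cocyclic with the next element.\<close>
  have "\<exists>h \<in> carrier G. C \<subseteq> generate G {h} \<and>
      (\<forall>z \<in> carrier G. (\<forall>x \<in> C. cocyclic z x) \<longrightarrow> cocyclic z h)"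
    using assms
  proof (induction C rule: finite_induct)
    case empty
    have "cocyclic z \<one>" if "z \<in> carrier G" for z
      unfolding cocyclic_def using that generate.incl[of z "{z}" G] generate.one by blast
    then show ?case by auto
  next
    case (insert x C)
    then obtain g where g: "g \<in> carrier G" "C \<subseteq> generate G {g}"
      and gz: "\<And>z. z \<in> carrier G \<Longrightarrow> \<forall>x \<in> C. cocyclic z x \<Longrightarrow> cocyclic z g"
      by auto
    have "cocyclic x g" using insert.prems by (intro gz) auto
    then obtain u v where u: "u \<in> generate G {x}" and v: "v \<in> generate G {g}"
      and uv: "coprime (ord u) (ord v)" "u \<otimes> v = v \<otimes> u"
      and w: "x \<in> generate G {u \<otimes> v}" "g \<in> generate G {u \<otimes> v}"
      using cyclic_coprime_decomposition unfolding cocyclic_def by metis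
    have wc: "u \<otimes> v \<in> carrier G"
      using u v g insert.prems generate_singleton_in_carrier by auto
    show ?case
    proof (intro bexI[OF _ wc] conjI ballI impI)
      show "insert x C \<subseteq> generate G {u \<otimes> v}"
        using w g(2) wc generate_singleton_subset by blast
    next
      fix z assume z: "z \<in> carrier G" "\<forall>y \<in> insert x C. cocyclic z y"
      then have "cocyclic z x" "cocyclic z g" using gz by auto
      \<comment> \<open>Cocyclicity passes to the powers \<open>u\<close> and \<open>v\<close>;
        their coprime orders let \<open>cocyclic_coprime_mult\<close> carry it to the new
        generator.\<close>
      then have "cocyclic z u" "cocyclic z v"
        using u v cocyclic_generate_left cocyclic_sym by blast+
      with uv show "cocyclic z (u \<otimes> v)" using cocyclic_coprime_mult by blast
    qed
  qed
  then show ?thesis by blast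
qed

text \<open>Inside a common cyclic group, the generator from
  \<open>cyclic_coprime_decomposition\<close> is a product of powers of \<open>x\<close> and
  \<open>y\<close>, so it generates exactly the subgroup generated by both.\<close>

lemma cyclic_group_pair_iff_cocyclic:
  assumes "x \<in> carrier G" "y \<in> carrier G"
  shows "cyclic_group (subgroup_generated G {x, y}) \<longleftrightarrow> cocyclic x y"
proof -
  have "cyclic_group (subgroup_generated G {x, y}) \<longleftrightarrow> cyclic_subgroup (generate G {x, y}) G"
    using assms generate_is_subgroup[of "{x, y}"]
    by (simp add: cyclic_subgroup_def subgroup_generated_def)
  also have "\<dots> \<longleftrightarrow> cocyclic x y"
  proof
    assume "cyclic_subgroup (generate G {x, y}) G"
    then show "cocyclic x y"
      unfolding cyclic_subgroup_iff cocyclic_def by (metis generate.incl insertCI)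
  next
    assume c: "cocyclic x y"
    then obtain u v where u: "u \<in> generate G {x}" and v: "v \<in> generate G {y}"
      and w: "x \<in> generate G {u \<otimes> v}" "y \<in> generate G {u \<otimes> v}"
      using cyclic_coprime_decomposition unfolding cocyclic_def by metis
    have wc: "u \<otimes> v \<in> carrier G"
      using u v assms generate_singleton_in_carrier by auto
    have "u \<in> generate G {x, y}" "v \<in> generate G {x, y}"
      using u v mono_generate[of "{x}" "{x, y}"] mono_generate[of "{y}" "{x, y}"] by auto
    then have "u \<otimes> v \<in> generate G {x, y}" by (rule generate.eng)
    then have "generate G {u \<otimes> v} \<subseteq> generate G {x, y}"
      using generate_subgroup_incl[of "{u \<otimes> v}"] generate_is_subgroup[of "{x, y}"] assms by simp
    moreover have "generate G {x, y} \<subseteq> generate G {u \<otimes> v}"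
      using generate_subgroup_incl[of "{x, y}"] generate_is_subgroup[of "{u \<otimes> v}"] w wc by simp
    ultimately show "cyclic_subgroup (generate G {x, y}) G"
      using wc by (auto simp: cyclic_subgroup_iff)
  qed
  finally show ?thesis .
qed

lemma cyclic_subset_maximal_cyclic:
  assumes "cyclic_subgroup H G"
  shows "\<exists>M \<in> maximal_cyclic_subgroups G. H \<subseteq> M"
proof -
  let ?C = "{C. cyclic_subgroup C G}"
  have "?C \<subseteq> Pow (carrier G)" by (auto simp: cyclic_subgroup_def dest: subgroup.subset)
  then have "finite ?C" using fin finite_subset by blast
  then obtain M where "M \<in> ?C" "H \<subseteq> M" "\<forall>C \<in> ?C. M \<subseteq> C \<longrightarrow> M = C"
    using finite_has_maximal2[of ?C H] assms by blast
  then show ?thesis by (auto simp: maximal_cyclic_subgroups_def)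
qed

section \<open>Maximal cyclic subgroups and closed neighborhoods\<close>

lemma dominates_enhanced_power_graph_iff:
  "x \<rightarrow>\<^bsub>enhanced_power_graph G\<^esub> y \<longleftrightarrow> x \<noteq> y \<and> cocyclic x y"
  using cyclic_group_pair_iff_cocyclic cocyclic_carrier
  by (auto simp: arcs_ends_conv enhanced_power_graph_def)

lemma closed_neighborhood_enhanced_power_graph:
  assumes "x \<in> carrier G"
  shows "closed_neighborhood (enhanced_power_graph G) x = {y. cocyclic x y}"
proof -
  have "cocyclic x x" using assms by (auto simp: cocyclic_def intro: generate.incl)
  then show ?thesis
    by (auto simp: closed_neighborhood_def dominates_enhanced_power_graph_iff)
qed

lemma pairwise_cocyclic_subset_maximal_cyclic:
  assumes "C \<subseteq> carrier G" "\<And>x y. x \<in> C \<Longrightarrow> y \<in> C \<Longrightarrow> cocyclic x y"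
  shows "\<exists>M \<in> maximal_cyclic_subgroups G. C \<subseteq> M"
proof -
  have "finite C" using assms fin finite_subset by blast
  then obtain h where "h \<in> carrier G" "C \<subseteq> generate G {h}"
    using pairwise_cocyclic_imp_cyclic[of C] assms by auto
  moreover from this have "cyclic_subgroup (generate G {h}) G"
    by (auto simp: cyclic_subgroup_iff)
  ultimately show ?thesis
    using cyclic_subset_maximal_cyclic[of "generate G {h}"] by (meson subset_trans)
qed

text \<open>If \<open>a\<close> and \<open>b\<close> have equal closed neighborhoods and
  \<open>a\<close> lies in a maximal cyclic \<open>M\<close>, then \<open>b\<close> is cocyclic with
  all of \<open>M\<close>. So \<open>insert b M\<close> lies in a maximal cyclic subgroup, which
  must be \<open>M\<close> itself. The converse recovers the neighborhood as a union of maximal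
  cyclic subgroups.\<close>

lemma closed_neighborhood_eq_iff:
  assumes x: "x \<in> carrier G" and y: "y \<in> carrier G"
  shows "closed_neighborhood (enhanced_power_graph G) x = closed_neighborhood (enhanced_power_graph G) y \<longleftrightarrow>
    maximal_cyclic_subgroups_at G x = maximal_cyclic_subgroups_at G y"
proof
  have *: "maximal_cyclic_subgroups_at G a \<subseteq> maximal_cyclic_subgroups_at G b"
    if eq: "{z. cocyclic a z} = {z. cocyclic b z}" and b: "b \<in> carrier G" for a b
  proof
    fix M assume "M \<in> maximal_cyclic_subgroups_at G a"
    then have M: "M \<in> maximal_cyclic_subgroups G" "a \<in> M"
      by (auto simp: maximal_cyclic_subgroups_at_def)
    note cyc = maximal_cyclic_subgroup_cyclic[OF M(1)]
    have inM: "cocyclic u v" if "u \<in> M" "v \<in> M" for u v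
      using that cyc cocyclic_if_mem_cyclic_subgroup by blast
    have bM: "cocyclic b v" if "v \<in> M" for v
      using inM[OF M(2) that] eq by blast
    have bb: "cocyclic b b" using b by (auto simp: cocyclic_def intro: generate.incl)
    have "cocyclic u v" if "u \<in> insert b M" "v \<in> insert b M" for u v
      using that inM bM bb cocyclic_sym by blast
    moreover have "insert b M \<subseteq> carrier G"
      using b cyclic_subgroup_subset_carrier[OF cyc] by blast
    ultimately obtain M' where "M' \<in> maximal_cyclic_subgroups G" "insert b M \<subseteq> M'"
      using pairwise_cocyclic_subset_maximal_cyclic[of "insert b M"] by blast
    then have "b \<in> M" using M(1) unfolding maximal_cyclic_subgroups_def by blast
    with M(1) show "M \<in> maximal_cyclic_subgroups_at G b"
      by (simp add: maximal_cyclic_subgroups_at_def)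
  qed
  assume "closed_neighborhood (enhanced_power_graph G) x = closed_neighborhood (enhanced_power_graph G) y"
  then have "{z. cocyclic x z} = {z. cocyclic y z}"
    using x y by (simp add: closed_neighborhood_enhanced_power_graph)
  then show "maximal_cyclic_subgroups_at G x = maximal_cyclic_subgroups_at G y"
    using *[of x y] *[of y x] x y by blast
next
  have *: "cocyclic a b \<longleftrightarrow> (\<exists>M \<in> maximal_cyclic_subgroups_at G a. b \<in> M)" for a b
  proof
    assume "cocyclic a b"
    then obtain g where g: "g \<in> carrier G" "a \<in> generate G {g}" "b \<in> generate G {g}"
      by (auto simp: cocyclic_def)
    then have "cyclic_subgroup (generate G {g}) G" by (auto simp: cyclic_subgroup_iff)
    then show "\<exists>M \<in> maximal_cyclic_subgroups_at G a. b \<in> M"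
      using cyclic_subset_maximal_cyclic g
      unfolding maximal_cyclic_subgroups_at_def by blast
  next
    assume "\<exists>M \<in> maximal_cyclic_subgroups_at G a. b \<in> M"
    then show "cocyclic a b"
      using cocyclic_if_mem_cyclic_subgroup maximal_cyclic_subgroup_cyclic
      unfolding maximal_cyclic_subgroups_at_def by blast
  qed
  assume "maximal_cyclic_subgroups_at G x = maximal_cyclic_subgroups_at G y"
  then show "closed_neighborhood (enhanced_power_graph G) x = closed_neighborhood (enhanced_power_graph G) y"
    using x y by (simp add: closed_neighborhood_enhanced_power_graph *)
qed

end

end

section \<open>The strong metric dimension of the enhanced power graph and the two maxima\<close>

theorem theorem4p5:
  fixes G :: "('a, 'c) monoid_scheme" and n :: nat
  assumes "group G" and "finite (carrier G)" and "order G = n"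
  shows "int (sdim (enhanced_power_graph G)) =
      int n - int (Max {card (neighborhood_classes (enhanced_power_graph G) M) | M.
                          M \<in> maximal_cyclic_subgroups G})
    \<and> int n - int (Max {card (neighborhood_classes (enhanced_power_graph G) M) | M.
                          M \<in> maximal_cyclic_subgroups G}) =
      int n - int (Max {card S | S. (\<exists>M \<in> maximal_cyclic_subgroups G. S \<subseteq> M) \<and>
                          (\<forall>x \<in> S. \<forall>y \<in> S. x \<noteq> y \<longrightarrow>
                             maximal_cyclic_subgroups_at G x \<noteq> maximal_cyclic_subgroups_at G y)})"
proof -
  interpret group G by fact
  note fin = assms(2)
  let ?\<Gamma> = "enhanced_power_graph G"
  let ?MC = "maximal_cyclic_subgroups G"
  let ?cls = "neighborhood_class ?\<Gamma>"
  let ?A = "{card (neighborhood_classes ?\<Gamma> M) | M. M \<in> ?MC}"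
  let ?B = "{card S | S. (\<exists>M \<in> ?MC. S \<subseteq> M) \<and>
    (\<forall>x \<in> S. \<forall>y \<in> S. x \<noteq> y \<longrightarrow>
      maximal_cyclic_subgroups_at G x \<noteq> maximal_cyclic_subgroups_at G y)}"
  define m where "m = Max ?A"
  have verts: "verts ?\<Gamma> = carrier G" by (simp add: enhanced_power_graph_def)
  have class_eq_iff: "?cls x = ?cls y \<longleftrightarrow> closed_neighborhood ?\<Gamma> x = closed_neighborhood ?\<Gamma> y"
    if "x \<in> carrier G" for x y
    using that by (intro neighborhood_class_eq_iff) (simp add: verts)
  have MC_sub: "M \<subseteq> carrier G" if "M \<in> ?MC" for M
    using that maximal_cyclic_subgroup_cyclic cyclic_subgroup_subset_carrier by blast
  have "?MC \<subseteq> Pow (carrier G)" using MC_sub by blast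
  then have "finite ?MC" using fin finite_subset by blast
  moreover have A_image: "?A = (\<lambda>M. card (neighborhood_classes ?\<Gamma> M)) ` ?MC" by blast
  ultimately have finA: "finite ?A" by simp
  have "?A \<noteq> {}" using maximal_cyclic_subgroups_ne[OF fin] by blast
  then have "m \<in> ?A" unfolding m_def using finA Max_in by blast
  then obtain M where M: "M \<in> ?MC" and mM: "m = card (?cls ` M)"
    by (auto simp: neighborhood_classes_def)
  \<comment> \<open>The condition on \<open>S\<close> in the second maximum becomes injectivity of
    the class map, the form shared by both computations.\<close>
  have class_inj_iff: "inj_on ?cls S \<longleftrightarrow> (\<forall>x \<in> S. \<forall>y \<in> S. x \<noteq> y \<longrightarrow>
      maximal_cyclic_subgroups_at G x \<noteq> maximal_cyclic_subgroups_at G y)"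
    if "S \<subseteq> carrier G" for S
  proof -
    have "?cls x = ?cls y \<longleftrightarrow>
        maximal_cyclic_subgroups_at G x = maximal_cyclic_subgroups_at G y"
      if "x \<in> S" "y \<in> S" for x y
      using class_eq_iff[of x y] closed_neighborhood_eq_iff[OF fin, of x y]
        that \<open>S \<subseteq> carrier G\<close> by blast
    then show ?thesis unfolding inj_on_def by blast
  qed
  have le_m: "card S \<le> m" if "N \<in> ?MC" "S \<subseteq> N" "inj_on ?cls S" for N S
  proof -
    have "finite N" using MC_sub[OF that(1)] fin finite_subset by blast
    then have "card S \<le> card (?cls ` N)"
      using that(2,3) by (metis card_image card_mono finite_imageI image_mono)
    also have "\<dots> \<le> m"
      unfolding m_def using finA that(1) by (intro Max_ge) (auto simp: neighborhood_classes_def)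
    finally show ?thesis .
  qed
  \<comment> \<open>\<open>C\<close> picks one representative of each class meeting the optimal
    \<open>M\<close>. It serves both as the largest clique for \<open>sdim_eq\<close> and as the set
    attaining the second maximum.\<close>
  obtain C where C: "C \<subseteq> M" "inj_on ?cls C" "?cls ` M = ?cls ` C"
    using subset_image_inj[THEN iffD1, OF order_refl] by metis
  then have cardC: "card C = m" using mM card_image by metis
  have Csub: "C \<subseteq> carrier G" using C(1) MC_sub[OF M] by blast

  interpret \<Gamma>: graph ?\<Gamma> by (rule graph_enhanced_power_graph[OF fin])
  have "sdim ?\<Gamma> = card (verts ?\<Gamma>) - card C"
  \<comment> \<open>The identity is the universal vertex, since it is a power of every
    element.\<close>
  proof (rule \<Gamma>.sdim_eq[of "\<one>\<^bsub>G\<^esub>"])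
    show "\<one>\<^bsub>G\<^esub> \<in> verts ?\<Gamma>" by (simp add: verts)
  next
    fix v assume "v \<in> verts ?\<Gamma>"
    then have "cocyclic \<one>\<^bsub>G\<^esub> v"
      unfolding verts cocyclic_def using generate.one generate.incl[of v "{v}" G] by blast
    then show "v \<in> closed_neighborhood ?\<Gamma> \<one>\<^bsub>G\<^esub>"
      by (simp add: closed_neighborhood_enhanced_power_graph[OF fin])
  next
    show "C \<subseteq> verts ?\<Gamma>" using Csub by (simp add: verts)
  next
    fix x y assume xy: "x \<in> C" "y \<in> C" "x \<noteq> y"
    have "cocyclic x y"
      using cocyclic_if_mem_cyclic_subgroup[OF maximal_cyclic_subgroup_cyclic[OF M]] xy C(1)
      by blast
    moreover have "closed_neighborhood ?\<Gamma> x \<noteq> closed_neighborhood ?\<Gamma> y"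
      using inj_onD[OF C(2)] xy class_eq_iff Csub by blast
    ultimately show "x \<rightarrow>\<^bsub>?\<Gamma>\<^esub> y \<and> closed_neighborhood ?\<Gamma> x \<noteq> closed_neighborhood ?\<Gamma> y"
      using xy by (simp add: dominates_enhanced_power_graph_iff[OF fin])
  next
    fix D assume D: "D \<subseteq> verts ?\<Gamma>"
      "\<And>x y. x \<in> D \<Longrightarrow> y \<in> D \<Longrightarrow> x \<noteq> y \<Longrightarrow>
        x \<rightarrow>\<^bsub>?\<Gamma>\<^esub> y \<and> closed_neighborhood ?\<Gamma> x \<noteq> closed_neighborhood ?\<Gamma> y"
    then have Dc: "D \<subseteq> carrier G" by (simp add: verts)
    have "cocyclic x y" if "x \<in> D" "y \<in> D" for x y
    proof (cases "x = y")
      case True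
      then show ?thesis
        using that Dc by (auto simp: cocyclic_def intro: generate.incl)
    next
      case False
      then show ?thesis using D(2) that by (simp add: dominates_enhanced_power_graph_iff[OF fin])
    qed
    \<comment> \<open>A competing clique lies in one maximal cyclic subgroup, where
      \<open>le_m\<close> bounds it by the number of classes.\<close>
    then obtain N where "N \<in> ?MC" "D \<subseteq> N"
      using pairwise_cocyclic_subset_maximal_cyclic[OF fin Dc] by blast
    moreover have "inj_on ?cls D"
      unfolding inj_on_def using D(2) Dc class_eq_iff by blast
    ultimately show "card D \<le> card C" using le_m cardC by simp
  qed
  \<comment> \<open>This keeps the truncated subtraction in \<open>sdim_eq\<close> equal to the
    integer difference.\<close>
  moreover have "m \<le> n"
    using card_mono[OF fin Csub] cardC assms(3) by (simp add: order_def)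
  ultimately have sdim: "int (sdim ?\<Gamma>) = int n - int m"
    using cardC assms(3) by (simp add: verts order_def)

  have "Max ?B = m"
  proof (rule Max_eqI)
    have B_le: "k \<le> m" if k: "k \<in> ?B" for k
    proof -
      obtain S N where S: "k = card S" "N \<in> ?MC" "S \<subseteq> N"
        "\<forall>x \<in> S. \<forall>y \<in> S. x \<noteq> y \<longrightarrow>
          maximal_cyclic_subgroups_at G x \<noteq> maximal_cyclic_subgroups_at G y"
        using k by blast
      then have "inj_on ?cls S" using class_inj_iff[of S] MC_sub by blast
      with S le_m show ?thesis by blast
    qed
    then show "\<And>k. k \<in> ?B \<Longrightarrow> k \<le> m" .
    \<comment> \<open>The upper bound \<open>m\<close> also yields finiteness, as \<open>?B\<close>
      is a set of natural numbers.\<close>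
    show "finite ?B" unfolding finite_nat_set_iff_bounded_le using B_le by blast
    have "\<forall>x \<in> C. \<forall>y \<in> C. x \<noteq> y \<longrightarrow>
        maximal_cyclic_subgroups_at G x \<noteq> maximal_cyclic_subgroups_at G y"
      using C(2) class_inj_iff[OF Csub] by (rule iffD1[rotated])
    then show "m \<in> ?B" using C(1) M cardC by blast
  qed
  with sdim show ?thesis unfolding m_def by simp
qed

end
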